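(* Let $k\geq 2$ and $n\geq 0$ be integers and $a_1,\dots,a_k>0$ real numbers. Then for all $x$, \[ \sum_{l_1+\dots+l_k=n}\binom{n}{l_1,\ldots,l_k} \frac{(a_1)_{l_1}\cdots(a_k)_{l_k}}{(a_1+\dots+a_k)_n}B_{l_1}(x)\cdots B_{l_k}(x) =\sum_{j=1}^k\sum_{\substack{J\subseteq\{1,\dots,k\}\\ |J|=j}}\frac{a_J\, n!}{(n+1-j)!} \sum_{l_0+l_1+\dots+l_{k-j}=n+1-j}\binom{n+1-j}{l_0,l_1,\ldots,l_{k-j}} \frac{(a_{i_{j+1}})_{l_1}\cdots(a_{i_k})_{l_{k-j}}}{(a_1+\dots+a_k)_{n+1-l_0}} B_{l_0}(x)B_{l_1}\cdots B_{l_{k-j}}, \] where all summation indices $l_i$ range over nonnegative integers, and for each $J$ one writes $\{1,\dots,k\}\setminus J=\{i_{j+1},\dots,i_k\}$ and $a_J=\prod_{i\in J}a_i$. Terms with $j>n+1$ (for which the inner sum is empty) are interpreted as $0$.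
   Context: The Bernoulli numbers $B_n$ are defined by $\frac{z}{e^z-1}=\sum_{n\ge0}B_n\frac{z^n}{n!}$ and the Bernoulli polynomials by $B_n(x)=\sum_{j=0}^n\binom{n}{j}B_jx^{n-j}$. The Pochhammer symbol is $(z)_0=1$, $(z)_m=z(z+1)\cdots(z+m-1)$ for $m\ge1$. $\binom{m}{l_0,\dots,l_r}$ denotes the multinomial coefficient. *)

theory Defs
  imports
    "HOL-Analysis.Analysis"
    "HOL-Computational_Algebra.Formal_Power_Series"
begin

text \<open>Numerator and denominator both have subdegree 1, so this is the exact
  quotient of formal power series; see \<open>bernoulli_num_gf\<close> below.\<close>

definition bernoulli_num :: "nat \<Rightarrow> 'a::field_char_0" where
  "bernoulli_num n = fact n * fps_nth (fps_X / (fps_exp 1 - 1)) n"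

definition bernoulli_poly :: "nat \<Rightarrow> 'a::field_char_0 \<Rightarrow> 'a" where
  "bernoulli_poly n x = (\<Sum>j\<le>n. of_nat (n choose j) * bernoulli_num j * x ^ (n - j))"

text \<open>Multi-indices are functions that are \<open>undefined\<close> outside \<open>I\<close>, so that each
  one occurs exactly once.\<close>

definition multi_indices :: "'i set \<Rightarrow> nat \<Rightarrow> ('i \<Rightarrow> nat) set" where
  "multi_indices I m = {l \<in> I \<rightarrow>\<^sub>E UNIV. (\<Sum>i\<in>I. l i) = m}"

definition multinomial :: "'i set \<Rightarrow> ('i \<Rightarrow> nat) \<Rightarrow> nat" where
  "multinomial I l = fact (\<Sum>i\<in>I. l i) div (\<Prod>i\<in>I. fact (l i))"

lemma bernoulli_num_gf:
  "(fps_exp 1 - 1) * Abs_fps (\<lambda>n. bernoulli_num n / fact n) = (fps_X :: 'a::field_char_0 fps)"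
proof -
  let ?E = "fps_exp 1 - 1 :: 'a fps"
  have 1: "fps_nth ?E 1 \<noteq> 0" "fps_nth ?E 0 = 0"
    by simp_all
  hence nz: "?E \<noteq> 0"
    by auto
  have sub: "subdegree ?E = 1"
    using 1 by (intro subdegreeI) auto
  have "?E dvd fps_X"
    using nz sub by (subst fps_dvd_iff) auto
  moreover have "Abs_fps (\<lambda>n. bernoulli_num n / fact n) = fps_X / ?E"
    by (rule fps_ext) (simp add: bernoulli_num_def)
  ultimately show ?thesis
    by simp
qed

lemma finite_multi_indices:
  assumes "finite I"
  shows "finite (multi_indices I m)"
proof (rule finite_subset)
  show "multi_indices I m \<subseteq> I \<rightarrow>\<^sub>E {..m}"
    using assms by (auto simp: multi_indices_def PiE_iff extensional_def intro: member_le_sum)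
  show "finite (I \<rightarrow>\<^sub>E {..m})"
    using assms by (intro finite_PiE) auto
qed

lemma prod_fact_dvd_fact_sum:
  assumes "finite I"
  shows "(\<Prod>i\<in>I. fact (l i)) dvd (fact (\<Sum>i\<in>I. l i) :: nat)"
  using assms
proof (induction I rule: finite_induct)
  case (insert i I)
  have "(\<Prod>i\<in>insert i I. fact (l i)) dvd fact (l i) * (fact (\<Sum>i\<in>I. l i) :: nat)"
    using insert by simp
  also have "\<dots> dvd fact (l i + (\<Sum>i\<in>I. l i))"
    by (rule fact_fact_dvd_fact)
  finally show ?case
    using insert by simp
qed simp

end

theory Submission
  imports Defs "HOL-Library.Poly_Mapping"
begin

text \<open>
  The ratios \<open>(a\<^sub>1)\<^bsub>l\<^sub>1\<^esub> \<cdots> (a\<^sub>k)\<^bsub>l\<^sub>k\<^esub> / (a\<^sub>1 + \<cdots> + a\<^sub>k)\<^bsub>l\<^sub>1+\<cdots>+l\<^sub>k\<^esub>\<close> are the moments of the Dirichlet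
  distribution, which lives on \<open>s = t\<^sub>1 + \<cdots> + t\<^sub>k = 1\<close>. Only this last fact is needed: the linear
  functional on polynomials in \<open>t\<close> with these moments is invariant under multiplication by \<open>s\<close>,
  so no integration is involved. Put \<open>b(z) = z / (e\<^sup>z - 1)\<close> and \<open>\<beta>(z) = e\<^bsup>xz\<^esup> b(z)\<close>. Multiplying out
  \<open>\<Prod> e\<^bsup>t\<^sub>i z\<^esup> b(t\<^sub>i z) = \<Prod> (t\<^sub>i z + b(t\<^sub>i z))\<close> yields
  \<open>s z \<Prod> \<beta>(t\<^sub>i z) = \<beta>(s z) \<Sum>\<^bsub>J\<noteq>{}\<^esub> \<Prod>\<^bsub>i\<in>J\<^esub> t\<^sub>i z \<Prod>\<^bsub>i\<notin>J\<^esub> b(t\<^sub>i z)\<close>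
  as power series in \<open>z\<close> over the polynomials in \<open>t\<close>. The theorem results from applying the functional
  to the coefficient of \<open>z\<^bsup>n+1\<^esup>\<close>.
\<close>

unbundle no vec_syntax
unbundle fps_syntax

section \<open>Multi-indices\<close>

lemma of_nat_multinomial:
  assumes "finite I"
  shows "(of_nat (multinomial I l) :: 'a::field_char_0) = fact (\<Sum>i\<in>I. l i) / (\<Prod>i\<in>I. fact (l i))"
proof -
  have "(\<Prod>i\<in>I. fact (l i)) * multinomial I l = fact (\<Sum>i\<in>I. l i)"
    using prod_fact_dvd_fact_sum[OF assms, of l] by (simp add: multinomial_def)
  hence "(of_nat ((\<Prod>i\<in>I. fact (l i)) * multinomial I l) :: 'a) = of_nat (fact (\<Sum>i\<in>I. l i))"
    by (rule arg_cong)
  hence "(\<Prod>i\<in>I. fact (l i)) * (of_nat (multinomial I l) :: 'a) = fact (\<Sum>i\<in>I. l i)"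
    by (simp add: of_nat_prod)
  thus ?thesis
    using assms by (simp add: field_simps)
qed

lemma sum_multi_indices_insert:
  fixes f :: "('i \<Rightarrow> nat) \<Rightarrow> 'b::comm_monoid_add"
  assumes "finite I" "i \<notin> I"
  shows "(\<Sum>l\<in>multi_indices (insert i I) m. f l)
    = (\<Sum>j=0..m. \<Sum>l\<in>multi_indices I (m - j). f (l(i := j)))"
proof -
  have "(\<Sum>j=0..m. \<Sum>l\<in>multi_indices I (m - j). f (l(i := j)))
    = (\<Sum>(j, l)\<in>(SIGMA j:{0..m}. multi_indices I (m - j)). f (l(i := j)))"
    using assms by (intro sum.Sigma) (auto intro: finite_multi_indices)
  also have "\<dots> = (\<Sum>l\<in>multi_indices (insert i I) m. f l)"
  \<comment> \<open>Resetting the value at \<open>i\<close> to \<open>undefined\<close> restores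
    extensionality on \<open>I\<close>, so the two maps are mutually inverse.\<close>
  proof (rule sum.reindex_bij_witness[where j = "\<lambda>(j, l). l(i := j)"
        and i = "\<lambda>l. (l i, l(i := undefined))"], goal_cases)
    case (1 p)
    thus ?case
      using assms by (auto simp: multi_indices_def PiE_iff extensional_def fun_eq_iff)
  next
    case (2 p)
    have "(\<Sum>x\<in>I. if x = i then j else l x) = (\<Sum>x\<in>I. l x)" for j and l :: "'i \<Rightarrow> nat"
      using assms by (intro sum.cong) auto
    with 2 show ?case
      using assms by (auto simp: multi_indices_def PiE_iff extensional_def fun_upd_def)
  next
    case (4 l)
    have "(\<Sum>x\<in>I. if x = i then undefined else l x) = (\<Sum>x\<in>I. l x)"
      using assms by (intro sum.cong) auto
    with 4 show ?case
      using assms by (auto simp: multi_indices_def PiE_iff extensional_def fun_upd_def)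
  qed auto
  finally show ?thesis ..
qed

text \<open>Iterated Cauchy product. The degree stays arbitrary in the induction because splitting
  off one factor lowers it.\<close>

lemma fps_nth_prod_multi_indices:
  fixes F :: "'i \<Rightarrow> 'b::comm_ring_1 fps"
  assumes "finite I"
  shows "(\<Prod>i\<in>I. F i) $ m = (\<Sum>l\<in>multi_indices I m. \<Prod>i\<in>I. F i $ l i)"
  using assms
proof (induction I arbitrary: m rule: finite_induct)
  case empty
  show ?case
    by (cases "m = 0") (auto simp: multi_indices_def)
next
  case (insert i I)
  have "(\<Prod>x\<in>insert i I. F x $ (l(i := j)) x) = F i $ j * (\<Prod>x\<in>I. F x $ l x)" for j l
    using insert by (auto intro!: arg_cong2[where f = "(*)"] prod.cong)
  thus ?case
    using insert by (simp add: sum_multi_indices_insert fps_mult_nth sum_distrib_left)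
qed

section \<open>The Dirichlet functional\<close>

type_synonym ('i, 'a) mpoly = "('i \<Rightarrow>\<^sub>0 nat) \<Rightarrow>\<^sub>0 'a"

definition mconst :: "'a::comm_ring_1 \<Rightarrow> ('i, 'a) mpoly" where
  "mconst c = Poly_Mapping.single 0 c"

definition mvar :: "'i \<Rightarrow> ('i, 'a::comm_ring_1) mpoly" where
  "mvar i = Poly_Mapping.single (Poly_Mapping.single i 1) 1"

lemma mconst_0 [simp]: "mconst 0 = 0"
  and mconst_1 [simp]: "mconst 1 = 1"
  and mconst_of_nat [simp]: "mconst (of_nat k) = of_nat k"
  and mconst_add: "mconst (c + d) = mconst c + mconst d"
  and mconst_diff: "mconst (c - d) = mconst c - mconst d"
  and mconst_mult: "mconst (c * d) = mconst c * mconst d"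
  by (simp_all add: mconst_def single_add single_diff mult_single)

lemma mconst_sum: "mconst (\<Sum>j\<in>X. f j) = (\<Sum>j\<in>X. mconst (f j))"
  by (induction X rule: infinite_finite_induct) (simp_all add: mconst_add)

lemma mconst_prod: "mconst (\<Prod>j\<in>X. f j) = (\<Prod>j\<in>X. mconst (f j))"
  by (induction X rule: infinite_finite_induct) (simp_all add: mconst_mult)

definition dirichlet_moment :: "('i \<Rightarrow> real) \<Rightarrow> 'i set \<Rightarrow> ('i \<Rightarrow> nat) \<Rightarrow> real" where
  "dirichlet_moment a I l
    = (\<Prod>i\<in>I. pochhammer (a i) (l i)) / pochhammer (\<Sum>i\<in>I. a i) (\<Sum>i\<in>I. l i)"

text \<open>Linear extension of the moments from monomials to polynomials; for positive parameters,
  the expectation in algebraic form. Exponents outside \<open>I\<close> are ignored, so variables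
  outside \<open>I\<close> act as 1.\<close>

definition dirichlet :: "('i \<Rightarrow> real) \<Rightarrow> 'i set \<Rightarrow> ('i, 'a::real_field) mpoly \<Rightarrow> 'a" where
  "dirichlet a I p = (\<Sum>m\<in>Poly_Mapping.keys p.
     Poly_Mapping.lookup p m * of_real (dirichlet_moment a I (Poly_Mapping.lookup m)))"

lemma dirichlet_0 [simp]: "dirichlet a I 0 = 0"
  by (simp add: dirichlet_def)

lemma dirichlet_add: "dirichlet a I (p + q) = dirichlet a I p + dirichlet a I q"
  unfolding dirichlet_def by (rule setsum_keys_plus_distrib) (simp_all add: distrib_right)

lemma dirichlet_sum: "dirichlet a I (\<Sum>j\<in>X. f j) = (\<Sum>j\<in>X. dirichlet a I (f j))"
  by (induction X rule: infinite_finite_induct) (simp_all add: dirichlet_add)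

lemma dirichlet_single:
  "dirichlet a I (Poly_Mapping.single m c) = c * of_real (dirichlet_moment a I (Poly_Mapping.lookup m))"
  by (simp add: dirichlet_def)

lemma mpoly_induct [case_names zero add]:
  assumes "P 0" "\<And>m c p. P p \<Longrightarrow> P (Poly_Mapping.single m c + p)"
  shows "P (p :: ('i, 'a::comm_ring_1) mpoly)"
proof (induction p rule: update_induct)
  case (update p m c)
  \<comment> \<open>The key \<open>m\<close> is new in \<open>p\<close>, so updating there amounts
    to adding a monomial.\<close>
  have "Poly_Mapping.update m c p = Poly_Mapping.single m c + p"
    using update by (intro poly_mapping_eqI)
      (auto simp: lookup_update lookup_add lookup_single in_keys_iff when_def)
  with update assms show ?case
    by simp
qed (use assms in simp)

lemma mvar_power: "mvar i ^ n = Poly_Mapping.single (Poly_Mapping.single i n) 1"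
  by (induction n) (simp_all add: mvar_def mult_single flip: single_add)

lemma prod_mvar_power:
  "(\<Prod>i\<in>I. mvar i ^ l i) = Poly_Mapping.single (\<Sum>i\<in>I. Poly_Mapping.single i (l i)) 1"
  by (induction I rule: infinite_finite_induct) (simp_all add: mvar_power mult_single)

lemma dirichlet_monomial:
  assumes "finite I"
  shows "dirichlet a I (mconst c * (\<Prod>i\<in>I. mvar i ^ l i)) = c * of_real (dirichlet_moment a I l)"
proof -
  have "Poly_Mapping.lookup (\<Sum>i\<in>I. Poly_Mapping.single i (l i)) i = l i" if "i \<in> I" for i
    using that assms by (simp add: lookup_sum lookup_single when_def)
  thus ?thesis
    by (simp add: prod_mvar_power mconst_def mult_single dirichlet_single dirichlet_moment_def)
qed

text \<open>Raising the exponent of \<open>i\<close> by one multiplies the moment by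
  \<open>(a i + l i) / (A + n)\<close>, where \<open>A\<close> is the sum of the parameters and
  \<open>n\<close> that of the exponents. These factors add up to 1.\<close>

lemma dirichlet_moment_shift:
  assumes "finite I" "(\<Sum>i\<in>I. a i) > 0"
  shows "(\<Sum>i\<in>I. dirichlet_moment a I (l(i := Suc (l i)))) = dirichlet_moment a I l"
proof -
  let ?A = "\<Sum>i\<in>I. a i" and ?n = "\<Sum>i\<in>I. l i"
  have pos: "pochhammer ?A m > 0" "?A + real m > 0" for m
    using assms by (auto intro: pochhammer_pos)
  have "dirichlet_moment a I (l(i := Suc (l i)))
      = (a i + real (l i)) * (dirichlet_moment a I l / (?A + ?n))" if i: "i \<in> I" for i
  proof -
    have "(\<Sum>j\<in>I. (l(i := Suc (l i))) j) = Suc ?n"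
      using assms(1) i by (simp add: sum.remove[of I i])
    moreover have "(\<Prod>j\<in>I. pochhammer (a j) ((l(i := Suc (l i))) j))
        = (a i + real (l i)) * (\<Prod>j\<in>I. pochhammer (a j) (l j))"
      using assms(1) i by (simp add: prod.remove[of I i] pochhammer_Suc)
    ultimately show ?thesis
      unfolding dirichlet_moment_def by (simp add: pochhammer_Suc mult_ac)
  qed
  hence "(\<Sum>i\<in>I. dirichlet_moment a I (l(i := Suc (l i))))
      = (\<Sum>i\<in>I. a i + real (l i)) * (dirichlet_moment a I l / (?A + ?n))"
    unfolding sum_distrib_right by (intro sum.cong) auto
  also have "(\<Sum>i\<in>I. a i + real (l i)) = ?A + ?n"
    by (simp add: sum.distrib)
  also have "(?A + ?n) * (dirichlet_moment a I l / (?A + ?n)) = dirichlet_moment a I l"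
    using pos(2)[of ?n] by simp
  finally show ?thesis .
qed

text \<open>By linearity a single monomial suffices, and there the claim is the shift identity for
  moments.\<close>

lemma dirichlet_sum_mvar_mult:
  assumes "finite I" "(\<Sum>i\<in>I. a i) > 0"
  shows "dirichlet a I ((\<Sum>i\<in>I. mvar i) * p) = dirichlet a I p"
proof (induction p rule: mpoly_induct)
  case (add m c p)
  have "Poly_Mapping.lookup (Poly_Mapping.single i 1 + m)
      = (Poly_Mapping.lookup m)(i := Suc (Poly_Mapping.lookup m i))" for i
    by (auto simp: lookup_add lookup_single when_def)
  hence "dirichlet a I ((\<Sum>i\<in>I. mvar i) * Poly_Mapping.single m c)
      = c * of_real (\<Sum>i\<in>I. dirichlet_moment a I
          ((Poly_Mapping.lookup m)(i := Suc (Poly_Mapping.lookup m i))))"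
    by (simp add: sum_distrib_right sum_distrib_left mvar_def mult_single dirichlet_sum dirichlet_single)
  also have "\<dots> = dirichlet a I (Poly_Mapping.single m c)"
    by (simp only: dirichlet_moment_shift[OF assms] dirichlet_single)
  finally show ?case
    using add by (simp add: distrib_left dirichlet_add)
qed simp

lemma dirichlet_sum_mvar_power_mult:
  assumes "finite I" "(\<Sum>i\<in>I. a i) > 0"
  shows "dirichlet a I ((\<Sum>i\<in>I. mvar i) ^ n * p) = dirichlet a I p"
  by (induction n) (simp_all add: mult.assoc dirichlet_sum_mvar_mult[OF assms])

section \<open>The substitution of \<open>p z\<close> for \<open>z\<close> in a power series\<close>

text \<open>The series f(p z). Its coefficients lie in the polynomial ring while those of
  \<open>f\<close> are scalars, hence the coefficientwise definition with the embedding
  \<open>mconst\<close>.\<close>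

definition fps_scale :: "('i, 'a::comm_ring_1) mpoly \<Rightarrow> 'a fps \<Rightarrow> ('i, 'a) mpoly fps" where
  "fps_scale p f = Abs_fps (\<lambda>n. mconst (f $ n) * p ^ n)"

lemma fps_scale_nth [simp]: "fps_scale p f $ n = mconst (f $ n) * p ^ n"
  by (simp add: fps_scale_def)

lemma fps_scale_1 [simp]: "fps_scale p 1 = 1"
  by (rule fps_ext) (simp add: fps_one_nth)

lemma fps_scale_X: "fps_scale p fps_X = fps_const p * fps_X"
  by (rule fps_ext) (auto simp: fps_X_def)

lemma fps_scale_diff: "fps_scale p (f - g) = fps_scale p f - fps_scale p g"
  by (rule fps_ext) (simp add: mconst_diff left_diff_distrib)

lemma fps_scale_mult: "fps_scale p (f * g) = fps_scale p f * fps_scale p g"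
proof (rule fps_ext)
  fix n
  have "mconst (f $ i) * mconst (g $ (n - i)) * p ^ n
      = mconst (f $ i) * p ^ i * (mconst (g $ (n - i)) * p ^ (n - i))" if "i \<in> {0..n}" for i
  proof -
    have "p ^ n = p ^ i * p ^ (n - i)"
      using that by (simp flip: power_add)
    thus ?thesis
      by (simp add: mult_ac)
  qed
  thus "fps_scale p (f * g) $ n = (fps_scale p f * fps_scale p g) $ n"
    by (simp add: fps_mult_nth mconst_sum mconst_mult sum_distrib_right)
qed

lemma fps_scale_0_exp: "fps_scale 0 (fps_exp (c :: 'a::field_char_0)) = 1"
  by (rule fps_ext) (simp add: fps_one_nth power_0_left)

text \<open>The functional equation of exp, obtained from the binomial theorem in the polynomial
  ring by comparing coefficients.\<close>

lemma fps_scale_add_exp: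
  fixes c :: "'a::field_char_0"
  shows "fps_scale (p + q) (fps_exp c) = fps_scale p (fps_exp c) * fps_scale q (fps_exp c)"
proof (rule fps_ext)
  fix n
  have "mconst (c ^ n / fact n) * (of_nat (n choose i) * p ^ i * q ^ (n - i))
      = mconst (c ^ i / fact i) * p ^ i * (mconst (c ^ (n - i) / fact (n - i)) * q ^ (n - i))"
    if "i \<le> n" for i
  proof -
    have "c ^ n / fact n * of_nat (n choose i) = c ^ i / fact i * (c ^ (n - i) / fact (n - i))"
      using that by (simp add: binomial_fact field_simps flip: power_add)
    hence "mconst (c ^ n / fact n * of_nat (n choose i)) * (p ^ i * q ^ (n - i))
        = mconst (c ^ i / fact i * (c ^ (n - i) / fact (n - i))) * (p ^ i * q ^ (n - i))"
      by (rule arg_cong)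
    thus ?thesis
      unfolding mconst_mult mconst_of_nat by (simp only: mult_ac)
  qed
  thus "fps_scale (p + q) (fps_exp c) $ n = (fps_scale p (fps_exp c) * fps_scale q (fps_exp c)) $ n"
    by (simp add: fps_mult_nth binomial_ring sum_distrib_left atLeast0AtMost)
qed

lemma fps_scale_sum_exp:
  fixes c :: "'a::field_char_0"
  shows "fps_scale (\<Sum>i\<in>I. p i) (fps_exp c) = (\<Prod>i\<in>I. fps_scale (p i) (fps_exp c))"
  by (induction I rule: infinite_finite_induct) (simp_all add: fps_scale_0_exp fps_scale_add_exp)

section \<open>Bernoulli generating functions\<close>

definition bernoulli_num_fps :: "'a::field_char_0 fps" where
  "bernoulli_num_fps = Abs_fps (\<lambda>n. bernoulli_num n / fact n)"

definition bernoulli_poly_fps :: "'a::field_char_0 \<Rightarrow> 'a fps" where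
  "bernoulli_poly_fps x = Abs_fps (\<lambda>n. bernoulli_poly n x / fact n)"

text \<open>Divided by \<open>fact n\<close>, the binomial sum defining the Bernoulli polynomial
  becomes a Cauchy product.\<close>

lemma bernoulli_poly_fps_eq: "bernoulli_poly_fps x = fps_exp x * bernoulli_num_fps"
proof (rule fps_ext)
  fix n
  have "bernoulli_poly n x / fact n
      = (\<Sum>j\<le>n. bernoulli_num j / fact j * (x ^ (n - j) / fact (n - j)))"
    unfolding bernoulli_poly_def sum_divide_distrib
    by (intro sum.cong) (auto simp: binomial_fact field_simps)
  also have "\<dots> = (bernoulli_num_fps * fps_exp x) $ n"
    by (simp add: fps_mult_nth bernoulli_num_fps_def atLeast0AtMost)
  finally show "bernoulli_poly_fps x $ n = (fps_exp x * bernoulli_num_fps) $ n"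
    by (simp add: bernoulli_poly_fps_def mult.commute)
qed

lemma exp_minus_1_mult_bernoulli_num_fps: "(fps_exp 1 - 1) * bernoulli_num_fps = fps_X"
  unfolding bernoulli_num_fps_def by (rule bernoulli_num_gf)

text \<open>Expand \<open>\<Prod> (E\<^sub>i b\<^sub>i)\<close> with \<open>E\<^sub>i = exp (p\<^sub>i z)\<close> and \<open>b\<^sub>i = p\<^sub>i z / (E\<^sub>i - 1)\<close>, using
  \<open>E\<^sub>i b\<^sub>i = p\<^sub>i z + b\<^sub>i\<close>.\<close>

lemma exp_minus_1_mult_prod_bernoulli:
  fixes p :: "'i \<Rightarrow> ('v, 'a::field_char_0) mpoly"
  assumes "finite I"
  shows "(fps_scale (\<Sum>i\<in>I. p i) (fps_exp 1) - 1) * (\<Prod>i\<in>I. fps_scale (p i) bernoulli_num_fps)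
    = (\<Sum>J\<in>Pow I - {{}}. fps_X ^ card J * (fps_const (\<Prod>i\<in>J. p i)
         * (\<Prod>i\<in>I - J. fps_scale (p i) bernoulli_num_fps)))"
proof -
  let ?b = "\<lambda>i. fps_scale (p i) bernoulli_num_fps"
  let ?f = "\<lambda>J. fps_X ^ card J * (fps_const (\<Prod>i\<in>J. p i) * (\<Prod>i\<in>I - J. ?b i))"
  have eq: "fps_scale (p i) (fps_exp 1) * ?b i = fps_const (p i) * fps_X + ?b i" for i
  proof -
    have "fps_scale (p i) ((fps_exp 1 - 1) * bernoulli_num_fps) = fps_const (p i) * fps_X"
      by (simp only: exp_minus_1_mult_bernoulli_num_fps fps_scale_X)
    thus ?thesis
      by (simp add: fps_scale_mult fps_scale_diff algebra_simps)
  qed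
  have const: "(\<Prod>i\<in>J. fps_const (p i)) = fps_const (\<Prod>i\<in>J. p i)" for J
    by (induction J rule: infinite_finite_induct) simp_all
  have "fps_scale (\<Sum>i\<in>I. p i) (fps_exp 1) * (\<Prod>i\<in>I. ?b i)
      = (\<Prod>i\<in>I. fps_const (p i) * fps_X + ?b i)"
    by (simp add: fps_scale_sum_exp eq flip: prod.distrib)
  also have "\<dots> = (\<Sum>J\<in>Pow I. ?f J)"
    by (simp add: prod_add[OF assms] prod.distrib const mult_ac)
  \<comment> \<open>The empty set contributes the bare product, which the -1 on the left-hand side
    cancels.\<close>
  also have "\<dots> = (\<Prod>i\<in>I. ?b i) + (\<Sum>J\<in>Pow I - {{}}. ?f J)"
    using assms by (subst sum.remove[where x = "{}"]) auto
  finally show ?thesis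
    by (simp add: algebra_simps)
qed

text \<open>With s the sum of the \<open>p i\<close>, \<beta>(s z) (exp(s z) - 1) = s z exp(x s z),
  and the product of the \<beta>(p_i z) is exp(x s z) times that of the b(p_i z). So multiplying the
  preceding expansion by \<beta>(s z) suffices; nothing is divided by exp(s z) - 1.\<close>

lemma prod_bernoulli_poly_expansion:
  fixes p :: "'i \<Rightarrow> ('v, 'a::field_char_0) mpoly"
  assumes "finite I"
  shows "fps_X * (fps_const (\<Sum>i\<in>I. p i) * (\<Prod>i\<in>I. fps_scale (p i) (bernoulli_poly_fps x)))
    = (\<Sum>J\<in>Pow I - {{}}. fps_X ^ card J * (fps_const (\<Prod>i\<in>J. p i)
         * (fps_scale (\<Sum>i\<in>I. p i) (bernoulli_poly_fps x)
            * (\<Prod>i\<in>I - J. fps_scale (p i) bernoulli_num_fps))))"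
proof -
  let ?s = "\<Sum>i\<in>I. p i" and ?b = "\<lambda>i. fps_scale (p i) bernoulli_num_fps"
  have "bernoulli_poly_fps x * (fps_exp 1 - 1)
      = fps_exp x * ((fps_exp 1 - 1) * bernoulli_num_fps)"
    unfolding bernoulli_poly_fps_eq by (simp only: mult_ac)
  also have "\<dots> = fps_exp x * fps_X"
    by (simp only: exp_minus_1_mult_bernoulli_num_fps)
  finally have "fps_scale ?s (bernoulli_poly_fps x * (fps_exp 1 - 1)) = fps_scale ?s (fps_exp x * fps_X)"
    by (rule arg_cong)
  hence eq: "fps_scale ?s (bernoulli_poly_fps x) * (fps_scale ?s (fps_exp 1) - 1)
      = fps_scale ?s (fps_exp x) * (fps_const ?s * fps_X)"
    by (simp only: fps_scale_mult fps_scale_diff fps_scale_1 fps_scale_X)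
  have "(\<Prod>i\<in>I. fps_scale (p i) (bernoulli_poly_fps x))
      = fps_scale ?s (fps_exp x) * (\<Prod>i\<in>I. ?b i)"
    by (simp add: bernoulli_poly_fps_eq fps_scale_mult fps_scale_sum_exp prod.distrib)
  hence "fps_X * (fps_const ?s * (\<Prod>i\<in>I. fps_scale (p i) (bernoulli_poly_fps x)))
      = fps_scale ?s (bernoulli_poly_fps x)
        * ((fps_scale ?s (fps_exp 1) - 1) * (\<Prod>i\<in>I. ?b i))"
    unfolding mult.assoc[symmetric, of "fps_scale ?s (bernoulli_poly_fps x)"] eq
    by (simp only: mult_ac)
  thus ?thesis
    unfolding exp_minus_1_mult_prod_bernoulli[OF assms] sum_distrib_left by (simp only: mult_ac)
qed

text \<open>The coefficient of z^(n+1). The conditional records that \<open>fps_X ^ card J\<close>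
  kills this coefficient when \<open>card J > n + 1\<close>, where the truncated difference would
  wrongly give index 0.\<close>

lemma sum_mvar_mult_prod_bernoulli_poly_nth:
  fixes x :: "'a::field_char_0"
  assumes "finite I"
  shows "(\<Sum>i\<in>I. mvar i) * (\<Prod>i\<in>I. fps_scale (mvar i) (bernoulli_poly_fps x)) $ n
    = (\<Sum>J\<in>Pow I - {{}}. if card J > n + 1 then 0 else
         (\<Prod>i\<in>J. mvar i) * (fps_scale (\<Sum>i\<in>I. mvar i) (bernoulli_poly_fps x)
            * (\<Prod>i\<in>I - J. fps_scale (mvar i) bernoulli_num_fps)) $ (n + 1 - card J))"
  using arg_cong[OF prod_bernoulli_poly_expansion[OF assms, of mvar x], of "\<lambda>f. f $ (n + 1)"]
  by (simp add: fps_sum_nth fps_X_power_mult_nth cong: if_cong)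

section \<open>Applying the functional to the coefficients\<close>

text \<open>The factor \<open>fact n\<close> combines with the denominators
  \<open>fact (l i)\<close> of the generating functions into the multinomial coefficient.\<close>

lemma dirichlet_prod_bernoulli_poly:
  fixes x :: "'a::real_field"
  assumes "finite I"
  shows "fact n * dirichlet a I ((\<Prod>i\<in>I. fps_scale (mvar i) (bernoulli_poly_fps x)) $ n)
    = (\<Sum>l\<in>multi_indices I n. of_nat (multinomial I l)
        * of_real ((\<Prod>i\<in>I. pochhammer (a i) (l i)) / pochhammer (\<Sum>i\<in>I. a i) n)
        * (\<Prod>i\<in>I. bernoulli_poly (l i) x))"
proof -
  have "fact n * dirichlet a I (\<Prod>i\<in>I. fps_scale (mvar i) (bernoulli_poly_fps x) $ l i)
      = of_nat (multinomial I l)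
        * of_real ((\<Prod>i\<in>I. pochhammer (a i) (l i)) / pochhammer (\<Sum>i\<in>I. a i) n)
        * (\<Prod>i\<in>I. bernoulli_poly (l i) x)" if "l \<in> multi_indices I n" for l
  proof -
    have n: "(\<Sum>i\<in>I. l i) = n"
      using that by (simp add: multi_indices_def)
    have "(\<Prod>i\<in>I. fps_scale (mvar i) (bernoulli_poly_fps x) $ l i)
        = mconst (\<Prod>i\<in>I. bernoulli_poly (l i) x / fact (l i)) * (\<Prod>i\<in>I. mvar i ^ l i)"
      by (simp add: prod.distrib mconst_prod bernoulli_poly_fps_def)
    hence "dirichlet a I (\<Prod>i\<in>I. fps_scale (mvar i) (bernoulli_poly_fps x) $ l i)
        = (\<Prod>i\<in>I. bernoulli_poly (l i) x / fact (l i)) * of_real (dirichlet_moment a I l)"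
      by (simp only: dirichlet_monomial[OF assms])
    thus ?thesis
      by (simp add: of_nat_multinomial[OF assms] n prod_dividef
          dirichlet_moment_def mult_ac)
  qed
  thus ?thesis
    by (simp add: fps_nth_prod_multi_indices[OF assms] dirichlet_sum sum_distrib_left)
qed

lemma dirichlet_monomial_subset:
  fixes c :: "'a::real_field" and a :: "'i \<Rightarrow> real"
  assumes "finite I" "J \<subseteq> I"
  shows "dirichlet a I (mconst c * ((\<Prod>i\<in>J. mvar i) * (\<Prod>i\<in>I - J. mvar i ^ l i)))
    = c * of_real ((\<Prod>i\<in>J. a i) * ((\<Prod>i\<in>I - J. pochhammer (a i) (l i))
        / pochhammer (\<Sum>i\<in>I. a i) (card J + (\<Sum>i\<in>I - J. l i))))"
proof -
  \<comment> \<open>Each variable in \<open>J\<close> has degree 1: it contributes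
    \<open>pochhammer (a i) 1 = a i\<close> to the numerator and 1 to the total degree.\<close>
  define l' where "l' i = (if i \<in> J then 1 else l i)" for i
  have split: "(\<Prod>i\<in>I. g i (l' i)) = (\<Prod>i\<in>J. g i 1) * (\<Prod>i\<in>I - J. g i (l i))"
    for g :: "'i \<Rightarrow> nat \<Rightarrow> 'd::comm_monoid_mult"
  proof -
    have "(\<Prod>i\<in>I. g i (l' i)) = (\<Prod>i\<in>J. g i (l' i)) * (\<Prod>i\<in>I - J. g i (l' i))"
      using assms by (metis mult.commute prod.subset_diff)
    thus ?thesis
      by (simp add: l'_def)
  qed
  have "(\<Sum>i\<in>I. l' i) = (\<Sum>i\<in>J. l' i) + (\<Sum>i\<in>I - J. l' i)"
    using assms by (metis add.commute sum.subset_diff)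
  hence "(\<Sum>i\<in>I. l' i) = card J + (\<Sum>i\<in>I - J. l i)"
    by (simp add: l'_def)
  thus ?thesis
    using dirichlet_monomial[OF assms(1), of a c l'] split[of "\<lambda>i n. mvar i ^ n :: ('i, 'a) mpoly"]
      split[of "\<lambda>i n. pochhammer (a i) n"]
    by (simp add: dirichlet_moment_def)
qed

text \<open>The fresh index \<open>z\<close> labels the factor \<beta>(s z). Its coefficient of
  degree \<open>l z\<close> carries s to the power \<open>l z\<close>, which the functional ignores;
  this is why the denominator has index \<open>N - l z\<close> and not \<open>N\<close>.\<close>

lemma dirichlet_bernoulli_poly_mult_prod_bernoulli_num:
  fixes x :: "'a::real_field"
  assumes I: "finite I" "(\<Sum>i\<in>I. a i) > 0" and J: "J \<subseteq> I" and z: "z \<notin> I"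
    and N: "card J \<le> N"
  shows "dirichlet a I ((\<Prod>i\<in>J. mvar i) * (fps_scale (\<Sum>i\<in>I. mvar i) (bernoulli_poly_fps x)
            * (\<Prod>i\<in>I - J. fps_scale (mvar i) bernoulli_num_fps)) $ (N - card J))
    = of_real ((\<Prod>i\<in>J. a i) / fact (N - card J))
      * (\<Sum>l\<in>multi_indices (insert z (I - J)) (N - card J).
           of_nat (multinomial (insert z (I - J)) l)
           * of_real ((\<Prod>i\<in>I - J. pochhammer (a i) (l i)) / pochhammer (\<Sum>i\<in>I. a i) (N - l z))
           * bernoulli_poly (l z) x * (\<Prod>i\<in>I - J. bernoulli_num (l i)))"
proof -
  let ?K = "insert z (I - J)" and ?s = "\<Sum>i\<in>I. mvar i"
  \<comment> \<open>Collecting all factors in one family over \<open>?K\<close> makes the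
    coefficient formula for products applicable.\<close>
  define F where "F i = (if i = z then fps_scale ?s (bernoulli_poly_fps x)
    else fps_scale (mvar i) bernoulli_num_fps)" for i
  have K: "finite ?K" "finite (I - J)" "z \<notin> I - J"
    using I z by auto
  have prod_F: "(\<Prod>i\<in>?K. f i (F i)) = f z (fps_scale ?s (bernoulli_poly_fps x))
      * (\<Prod>i\<in>I - J. f i (fps_scale (mvar i) bernoulli_num_fps))"
    for f :: "_ \<Rightarrow> _ \<Rightarrow> 'd::comm_monoid_mult"
  proof -
    have "(\<Prod>i\<in>I - J. f i (F i)) = (\<Prod>i\<in>I - J. f i (fps_scale (mvar i) bernoulli_num_fps))"
      using z by (intro prod.cong) (auto simp: F_def)
    thus ?thesis
      using K by (simp add: F_def)
  qed
  have "dirichlet a I ((\<Prod>i\<in>J. mvar i) * (\<Prod>i\<in>?K. F i $ l i))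
      = of_real ((\<Prod>i\<in>J. a i) / fact (N - card J))
        * (of_nat (multinomial ?K l)
           * of_real ((\<Prod>i\<in>I - J. pochhammer (a i) (l i)) / pochhammer (\<Sum>i\<in>I. a i) (N - l z))
           * bernoulli_poly (l z) x * (\<Prod>i\<in>I - J. bernoulli_num (l i)))"
    if "l \<in> multi_indices ?K (N - card J)" for l
  proof -
    have sum_l: "(\<Sum>i\<in>?K. l i) = N - card J"
      using that by (simp add: multi_indices_def)
    \<comment> \<open>The degree that remains for the moment once the power of \<open>?s\<close> is
      dropped; \<open>card J \<le> N\<close> keeps the subtraction exact.\<close>
    hence deg: "card J + (\<Sum>i\<in>I - J. l i) = N - l z"
      using K N by simp
    define c where "c = bernoulli_poly (l z) x / fact (l z)
      * (\<Prod>i\<in>I - J. bernoulli_num (l i) / fact (l i))"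
    have "(\<Prod>i\<in>J. mvar i) * (\<Prod>i\<in>?K. F i $ l i)
        = ?s ^ l z * (mconst c * ((\<Prod>i\<in>J. mvar i) * (\<Prod>i\<in>I - J. mvar i ^ l i)))"
      unfolding c_def mconst_mult
      by (simp add: prod_F[of "\<lambda>i f. f $ l i"] bernoulli_poly_fps_def bernoulli_num_fps_def
          prod.distrib mconst_prod mult_ac)
    hence "dirichlet a I ((\<Prod>i\<in>J. mvar i) * (\<Prod>i\<in>?K. F i $ l i))
        = c * of_real ((\<Prod>i\<in>J. a i) * ((\<Prod>i\<in>I - J. pochhammer (a i) (l i))
            / pochhammer (\<Sum>i\<in>I. a i) (N - l z)))"
      by (simp only: dirichlet_sum_mvar_power_mult[OF I] dirichlet_monomial_subset[OF I(1) J] deg)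
    moreover have "c = of_nat (multinomial ?K l) / fact (N - card J)
        * bernoulli_poly (l z) x * (\<Prod>i\<in>I - J. bernoulli_num (l i))"
    proof -
      have "(of_nat (multinomial ?K l) :: 'a)
          = fact (N - card J) / (fact (l z) * (\<Prod>i\<in>I - J. fact (l i)))"
        using K by (simp only: of_nat_multinomial[OF K(1)] sum_l) simp
      thus ?thesis
        by (simp add: c_def prod_dividef)
    qed
    ultimately show ?thesis
      by (simp add: mult_ac)
  qed
  moreover have "fps_scale ?s (bernoulli_poly_fps x)
      * (\<Prod>i\<in>I - J. fps_scale (mvar i) bernoulli_num_fps) = (\<Prod>i\<in>?K. F i)"
    using prod_F[of "\<lambda>_ f. f"] by simp
  ultimately show ?thesis
    by (simp only: fps_nth_prod_multi_indices[OF K(1)] sum_distrib_left dirichlet_sum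
        cong: sum.cong)
qed

theorem theorem2:
  fixes k n :: nat and a :: "nat \<Rightarrow> real" and x :: "'a::real_field"
  assumes "k \<ge> 2"
    and "\<And>i. i \<in> {1..k} \<Longrightarrow> a i > 0"
  shows
    "(\<Sum>l\<in>multi_indices {1..k} n.
        of_nat (multinomial {1..k} l)
        * of_real ((\<Prod>i=1..k. pochhammer (a i) (l i)) / pochhammer (\<Sum>i=1..k. a i) n)
        * (\<Prod>i=1..k. bernoulli_poly (l i) x))
     = (\<Sum>j=1..k. \<Sum>J | J \<subseteq> {1..k} \<and> card J = j.
          if j > n + 1 then 0 else
            of_real ((\<Prod>i\<in>J. a i) * fact n / fact (n + 1 - j))
            * (\<Sum>l\<in>multi_indices (insert 0 ({1..k} - J)) (n + 1 - j).
                 of_nat (multinomial (insert 0 ({1..k} - J)) l)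
                 * of_real ((\<Prod>i\<in>{1..k} - J. pochhammer (a i) (l i))
                            / pochhammer (\<Sum>i=1..k. a i) (n + 1 - l 0))
                 * bernoulli_poly (l 0) x
                 * (\<Prod>i\<in>{1..k} - J. bernoulli_num (l i))))"
    (is "?lhs = (\<Sum>j=1..k. \<Sum>J | J \<subseteq> {1..k} \<and> card J = j. ?R j J)")
proof -
  let ?I = "{1..k}"
  let ?s = "\<Sum>i\<in>?I. mvar i :: (nat, 'a) mpoly"
  let ?G = "\<lambda>J. (\<Prod>i\<in>J. mvar i) * (fps_scale ?s (bernoulli_poly_fps x)
            * (\<Prod>i\<in>?I - J. fps_scale (mvar i) bernoulli_num_fps)) $ (n + 1 - card J)"
  have pos: "(\<Sum>i\<in>?I. a i) > 0"
    using assms by (intro sum_pos) auto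
  \<comment> \<open>The index 0 is fresh because \<open>?I\<close> starts at 1, and \<open>N\<close>
    is \<open>n + 1\<close>.\<close>
  have term_eq: "fact n * dirichlet a ?I (if card J > n + 1 then 0 else ?G J) = ?R (card J) J"
    if "J \<in> Pow ?I - {{}}" for J
    using dirichlet_bernoulli_poly_mult_prod_bernoulli_num[of ?I a J 0 "n + 1" x] pos that by simp
  \<comment> \<open>Invariance of the functional inserts the factor \<open>?s\<close>, which the
    expansion requires.\<close>
  have "?lhs = fact n * dirichlet a ?I
      (?s * (\<Prod>i\<in>?I. fps_scale (mvar i) (bernoulli_poly_fps x)) $ n)"
    using dirichlet_prod_bernoulli_poly[of ?I n a x] 
      dirichlet_sum_mvar_mult[of ?I a, of "(\<Prod>i\<in>?I. fps_scale (mvar i) (bernoulli_poly_fps x)) $ n"] pos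
    by simp
  also have "\<dots> = (\<Sum>J\<in>Pow ?I - {{}}.
      fact n * dirichlet a ?I (if card J > n + 1 then 0 else ?G J))"
    by (simp only: sum_mvar_mult_prod_bernoulli_poly_nth[OF finite_atLeastAtMost]
        dirichlet_sum sum_distrib_left)
  also have "\<dots> = (\<Sum>J\<in>Pow ?I - {{}}. ?R (card J) J)"
    by (intro sum.cong refl term_eq)
  also have "\<dots> = (\<Sum>j=1..k. \<Sum>J | J \<in> Pow ?I - {{}} \<and> card J = j. ?R (card J) J)"
  proof (rule sum.group[symmetric])
    show "card ` (Pow ?I - {{}}) \<subseteq> {1..k}"
    proof
      fix j assume "j \<in> card ` (Pow ?I - {{}})"
      then obtain J where J: "J \<subseteq> ?I" "J \<noteq> {}" "j = card J"
        by auto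
      moreover have "finite J"
        using J(1) finite_subset by blast
      ultimately show "j \<in> {1..k}"
        using card_mono[of ?I J] card_gt_0_iff[of J] by auto
    qed
  qed auto
  also have "\<dots> = (\<Sum>j=1..k. \<Sum>J | J \<subseteq> {1..k} \<and> card J = j. ?R j J)"
    by (intro sum.cong) auto
  finally show ?thesis .
qed

end
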